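(* Let $(\mathfrak{g}, [\cdot,\cdot]_{\mathfrak{g}}, \alpha_{\mathfrak{g}}, \langle\cdot,\cdot\rangle)$ be a pseudo-Riemannian (regular) Hom-Lie algebra. Then the set $\mathfrak{K}$ of Killing vectors of $\mathfrak{g}$ is a Hom-Lie subalgebra of $\mathfrak{g}$.
   Context: A Hom-Lie algebra is a triple $(\mathfrak{g},[\cdot,\cdot]_{\mathfrak{g}},\alpha_{\mathfrak{g}})$ where $\mathfrak{g}$ is a (here finite-dimensional real) vector space, $[\cdot,\cdot]_{\mathfrak{g}}:\mathfrak{g}\times\mathfrak{g}\to\mathfrak{g}$ is a skew-symmetric bilinear map, and $\alpha_{\mathfrak{g}}:\mathfrak{g}\to\mathfrak{g}$ is a linear map with $\alpha_{\mathfrak{g}}([x,y]_{\mathfrak{g}})=[\alpha_{\mathfrak{g}}(x),\alpha_{\mathfrak{g}}(y)]_{\mathfrak{g}}$ for all $x,y$, such that the Hom-Jacobi identity $[\alpha_{\mathfrak{g}}(x),[y,z]_{\mathfrak{g}}]_{\mathfrak{g}}+[\alpha_{\mathfrak{g}}(y),[z,x]_{\mathfrak{g}}]_{\mathfrak{g}}+[\alpha_{\mathfrak{g}}(z),[x,y]_{\mathfrak{g}}]_{\mathfrak{g}}=0$ holds for all $x,y,z\in\mathfrak{g}$. It is regular if $\alpha_{\mathfrak{g}}$ is invertible; all Hom-Lie algebras are assumed regular. A Hom-Lie subalgebra is a linear subspace $\mathfrak{h}\subseteq\mathfrak{g}$ with $\alpha_{\mathfrak{g}}(\mathfrak{h})\subseteq\mathfrak{h}$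 and $[x,y]_{\mathfrak{g}}\in\mathfrak{h}$ for all $x,y\in\mathfrak{h}$. A pseudo-Riemannian Hom-Lie algebra is such a triple together with a non-degenerate symmetric bilinear form $\langle\cdot,\cdot\rangle:\mathfrak{g}\times\mathfrak{g}\to\mathbb{R}$ with $\langle\alpha_{\mathfrak{g}}(x),\alpha_{\mathfrak{g}}(y)\rangle=\langle x,y\rangle$ for all $x,y$. The Hom-Levi-Civita connection is the unique bilinear map $\nabla:\mathfrak{g}\times\mathfrak{g}\to\mathfrak{g}$, $(x,y)\mapsto\nabla_x y$, given by the Koszul formula $$2\langle\nabla_x y,\alpha_{\mathfrak{g}}(z)\rangle=\langle[x,y]_{\mathfrak{g}},\alpha_{\mathfrak{g}}(z)\rangle+\langle[z,y]_{\mathfrak{g}},\alpha_{\mathfrak{g}}(x)\rangle+\langle[z,x]_{\mathfrak{g}},\alpha_{\mathfrak{g}}(y)\rangle$$ for all $x,y,z\in\mathfrak{g}$. It satisfies $[x,y]_{\mathfrak{g}}=\nabla_x y-\nabla_y x$, $\langle\nabla_x y,\alpha_{\mathfrak{g}}(z)\rangle=-\langle\alpha_{\mathfrak{g}}(y),\nabla_x z\rangle$ and $\alpha_{\mathfrak{g}}(\nabla_x y)=\nabla_{\alpha_{\mathfrak{g}}(x)}\alpha_{\mathfrak{g}}(y)$. A vector $v\in\mathfrak{g}$ is Killing if $\langle\nabla_x v,\alpha_{\mathfrak{g}}(y)\rangle=-\langle\nabla_y v,\alpha_{\mathfrak{g}}(x)\rangle$ for all $x,y\in\mathfrak{g}$.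 *)

theory Defs
  imports "HOL-Analysis.Analysis"
begin

text \<open>
  The underlying space is a whole type of class \<^class>\<open>real_vector\<close> together with a finite spanning
  set. The class \<^class>\<open>euclidean_space\<close> is avoided because it would fix a background inner product
  and exclude the zero space.
\<close>

locale regular_hom_lie_algebra =
  fixes br :: "'a::real_vector \<Rightarrow> 'a \<Rightarrow> 'a" and \<alpha> :: "'a \<Rightarrow> 'a"
  assumes finite_dim: "\<exists>S::'a set. finite S \<and> span S = UNIV"
    and bilinear_br: "bilinear br"
    and skew: "br x y = - br y x"
    and linear_alpha: "linear \<alpha>"
    and alpha_br: "\<alpha> (br x y) = br (\<alpha> x) (\<alpha> y)"
    and hom_Jacobi: "br (\<alpha> x) (br y z) + br (\<alpha> y) (br z x) + br (\<alpha> z) (br x y) = 0"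
    and bij_alpha: "bij \<alpha>"

definition hom_lie_subalgebra ::
    "('a::real_vector \<Rightarrow> 'a \<Rightarrow> 'a) \<Rightarrow> ('a \<Rightarrow> 'a) \<Rightarrow> 'a set \<Rightarrow> bool" where
  "hom_lie_subalgebra br \<alpha> H \<longleftrightarrow>
     subspace H \<and> \<alpha> ` H \<subseteq> H \<and> (\<forall>x\<in>H. \<forall>y\<in>H. br x y \<in> H)"

locale pseudo_riemannian_hom_lie_algebra = regular_hom_lie_algebra br \<alpha>
  for br :: "'a::real_vector \<Rightarrow> 'a \<Rightarrow> 'a" and \<alpha> :: "'a \<Rightarrow> 'a" +
  fixes g :: "'a \<Rightarrow> 'a \<Rightarrow> real"
  assumes bilinear_metric: "bilinear g"
    and metric_sym: "g x y = g y x"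
    and metric_nondegenerate: "(\<And>y. g x y = 0) \<Longrightarrow> x = 0"
    and metric_alpha: "g (\<alpha> x) (\<alpha> y) = g x y"

definition is_hom_levi_civita ::
    "('a::real_vector \<Rightarrow> 'a \<Rightarrow> 'a) \<Rightarrow> ('a \<Rightarrow> 'a) \<Rightarrow> ('a \<Rightarrow> 'a \<Rightarrow> real) \<Rightarrow> ('a \<Rightarrow> 'a \<Rightarrow> 'a) \<Rightarrow> bool" where
  "is_hom_levi_civita br \<alpha> g D \<longleftrightarrow>
     bilinear D \<and>
     (\<forall>x y z. 2 * g (D x y) (\<alpha> z) = g (br x y) (\<alpha> z) + g (br z y) (\<alpha> x) + g (br z x) (\<alpha> y))"

text \<open>The description is proper: see \<open>ex1_hom_levi_civita\<close> below.\<close>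

definition hom_levi_civita ::
    "('a::real_vector \<Rightarrow> 'a \<Rightarrow> 'a) \<Rightarrow> ('a \<Rightarrow> 'a) \<Rightarrow> ('a \<Rightarrow> 'a \<Rightarrow> real) \<Rightarrow> 'a \<Rightarrow> 'a \<Rightarrow> 'a" where
  "hom_levi_civita br \<alpha> g = (THE D. is_hom_levi_civita br \<alpha> g D)"

definition killing_vectors ::
    "('a::real_vector \<Rightarrow> 'a \<Rightarrow> 'a) \<Rightarrow> ('a \<Rightarrow> 'a) \<Rightarrow> ('a \<Rightarrow> 'a \<Rightarrow> real) \<Rightarrow> 'a set" where
  "killing_vectors br \<alpha> g =
     {v. \<forall>x y. g (hom_levi_civita br \<alpha> g x v) (\<alpha> y) = - g (hom_levi_civita br \<alpha> g y v) (\<alpha> x)}"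

lemma nondegenerate_form_represents:
  fixes g :: "'a::real_vector \<Rightarrow> 'a \<Rightarrow> real"
  assumes fin: "\<exists>S::'a set. finite S \<and> span S = UNIV"
    and g: "bilinear g" and nd: "\<And>x. (\<And>y. g x y = 0) \<Longrightarrow> x = 0"
    and f: "linear f"
  shows "\<exists>w. \<forall>z. g w z = f z"
proof -
  obtain S :: "'a set" where S: "finite S" "span S = UNIV" using fin by blast
  obtain B where B: "B \<subseteq> S" "independent B" "S \<subseteq> span B"
    using maximal_independent_subset by blast
  have finB: "finite B" using B(1) S(1) finite_subset by blast
  have spB: "span B = UNIV" using B(3) S(2) by (metis span_span span_mono top.extremum_uniqueI)
  interpret FD: finite_dimensional_vector_space "scaleR :: real \<Rightarrow> 'a \<Rightarrow> 'a" B
    by unfold_locales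
      (use finB B(2) spB in \<open>auto simp: dependent_raw_def span_raw_def\<close>)
  have gl: "linear (g x)" "linear (\<lambda>x. g x y)" for x y
    using g unfolding bilinear_def by auto
  define T where "T x = (\<Sum>b\<in>B. g x b *\<^sub>R b)" for x
  have linT: "linear T"
    by (rule linearI)
       (simp_all add: T_def linear_add[OF gl(2)] linear_scale[OF gl(2)] scaleR_left_distrib
          sum.distrib scaleR_sum_right)
  have coeff: "\<forall>b\<in>B. c b = d b" if "(\<Sum>b\<in>B. c b *\<^sub>R b) = (\<Sum>b\<in>B. d b *\<^sub>R b)" for c d :: "'a \<Rightarrow> real"
  proof -
    have "(\<Sum>b\<in>B. (c b - d b) *\<^sub>R b) = 0"
      using that by (simp add: scaleR_left_diff_distrib sum_subtractf)
    then show ?thesis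
      using independentD[OF B(2) finB subset_refl, of "\<lambda>b. c b - d b"] by auto
  qed
  have eqB: "f1 = f2" if "linear f1" "linear f2" "\<forall>b\<in>B. f1 b = f2 b" for f1 f2 :: "'a \<Rightarrow> real"
    using linear_eq_on_span[of f1 f2 B] that spB by blast
  have "inj T"
    unfolding linear_injective_0[OF linT]
  proof (intro allI impI)
    fix x assume "T x = 0"
    then have "\<forall>b\<in>B. g x b = 0" using coeff[of "g x" "\<lambda>_. 0"] by (simp add: T_def)
    then have "g x = (\<lambda>_. 0)" using eqB[OF gl(1)[of x], of "\<lambda>_. 0"] by (simp add: linear_zero)
    then show "x = 0" using nd by metis
  qed
  then have "surj T" 
    using FD.linear_inj_imp_surj linT by (simp add: linear_def)
  then obtain w where "T w = (\<Sum>b\<in>B. f b *\<^sub>R b)" by (metis surjD)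
  then have "\<forall>b\<in>B. g w b = f b" using coeff by (simp add: T_def)
  then have "g w = f" using eqB gl(1) f by blast
  then show ?thesis by auto
qed

lemma (in pseudo_riemannian_hom_lie_algebra) ex1_hom_levi_civita:
  "\<exists>!D. is_hom_levi_civita br \<alpha> g D"
proof -
  have gl: "linear (g x)" "linear (\<lambda>x. g x y)" for x y
    using bilinear_metric unfolding bilinear_def by auto
  have bl: "linear (br x)" "linear (\<lambda>x. br x y)" for x y
    using bilinear_br unfolding bilinear_def by auto
  note lin = linear_add[OF gl(1)] linear_add[OF gl(2)] linear_add[OF bl(1)] linear_add[OF bl(2)]
    linear_add[OF linear_alpha]
    linear_scale[OF gl(1)] linear_scale[OF gl(2)] linear_scale[OF bl(1)] linear_scale[OF bl(2)]
    linear_scale[OF linear_alpha]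
  have eqI: "u = w" if "\<And>z. g u (\<alpha> z) = g w (\<alpha> z)" for u w
  proof -
    have "g (u - w) y = 0" for y
    proof -
      obtain z where "y = \<alpha> z" using bij_alpha by (metis bij_pointE)
      then show ?thesis using that by (simp add: linear_diff[OF gl(2)])
    qed
    then show ?thesis using metric_nondegenerate[of "u - w"] by simp
  qed
  define R where "R x y z = g (br x y) (\<alpha> z) + g (br z y) (\<alpha> x) + g (br z x) (\<alpha> y)" for x y z
  have "\<exists>w. \<forall>z. 2 * g w (\<alpha> z) = R x y z" for x y
  proof -
    have li: "linear (inv \<alpha>)"
      by (rule linearI; rule inj_onD[OF bij_is_inj[OF bij_alpha]])
        (simp_all add: lin surj_f_inv_f[OF bij_is_surj[OF bij_alpha]])
    have "linear (\<lambda>z. R x y (inv \<alpha> z) / 2)"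
      by (rule linearI) (simp_all add: R_def lin linear_add[OF li] linear_scale[OF li] field_simps)
    then obtain w where "\<forall>z. g w z = R x y (inv \<alpha> z) / 2"
      using nondegenerate_form_represents[OF finite_dim bilinear_metric metric_nondegenerate] by blast
    then have "2 * g w (\<alpha> z) = R x y z" for z
      by (simp only: inv_f_f[OF bij_is_inj[OF bij_alpha]])
    then show ?thesis by blast
  qed
  then obtain D where D: "\<And>x y z. 2 * g (D x y) (\<alpha> z) = R x y z" by metis
  have D': "g (D x y) (\<alpha> z) = R x y z / 2" for x y z using D[of x y z] by simp
  have "bilinear D" unfolding bilinear_def
    by (intro conjI allI linearI eqI) (simp_all add: lin D' R_def field_simps)
  then have "is_hom_levi_civita br \<alpha> g D" using D by (simp add: is_hom_levi_civita_def R_def)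
  moreover have "D' = D" if "is_hom_levi_civita br \<alpha> g D'" for D'
  proof (intro ext eqI)
    fix x y z
    have "2 * g (D' x y) (\<alpha> z) = R x y z" using that by (simp add: is_hom_levi_civita_def R_def)
    then show "g (D' x y) (\<alpha> z) = g (D x y) (\<alpha> z)" using D[of x y z] by simp
  qed
  ultimately show ?thesis by blast
qed

end

theory Submission
  imports Defs
begin

text \<open>
  In the symmetrised Koszul formula the terms containing \<open>br x y\<close> cancel, so \<open>v\<close> is Killing iff
  \<open>br v\<close> is skew with respect to \<open>g\<close>, up to a twist by \<open>\<alpha>\<close>. Hom-Jacobi writes the action of \<open>br u v\<close>
  as a twisted commutator, and a commutator of skew maps is skew.
\<close>

context pseudo_riemannian_hom_lie_algebra
begin

text \<open>\<open>hom_levi_civita\<close> is a definite description, so its formula becomes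
  available only through \<open>ex1_hom_levi_civita\<close>.\<close>

lemma hom_levi_civita_koszul:
  "2 * g (hom_levi_civita br \<alpha> g x y) (\<alpha> z) =
     g (br x y) (\<alpha> z) + g (br z y) (\<alpha> x) + g (br z x) (\<alpha> y)"
proof -
  have "is_hom_levi_civita br \<alpha> g (hom_levi_civita br \<alpha> g)"
    unfolding hom_levi_civita_def by (rule theI'[OF ex1_hom_levi_civita])
  then show ?thesis
    unfolding is_hom_levi_civita_def by blast
qed

lemma killing_iff_skew:
  "v \<in> killing_vectors br \<alpha> g \<longleftrightarrow> (\<forall>x y. g (br v x) (\<alpha> y) = - g (br v y) (\<alpha> x))"
proof -
  \<comment> \<open>The surviving Koszul terms agree in pairs, which absorbs the factor 2; the sign
    comes from turning \<open>br x v\<close> into \<open>- br v x\<close>.\<close>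
  have "g (hom_levi_civita br \<alpha> g x v) (\<alpha> y) + g (hom_levi_civita br \<alpha> g y v) (\<alpha> x)
      = - (g (br v x) (\<alpha> y) + g (br v y) (\<alpha> x))" for x y
    using hom_levi_civita_koszul[of x v y] hom_levi_civita_koszul[of y v x]
    by (simp add: skew[of x v] skew[of y v] skew[of y x] bilinear_lneg[OF bilinear_metric])
  then have "g (hom_levi_civita br \<alpha> g x v) (\<alpha> y) = - g (hom_levi_civita br \<alpha> g y v) (\<alpha> x)
      \<longleftrightarrow> g (br v x) (\<alpha> y) = - g (br v y) (\<alpha> x)" for x y
    by (metis eq_neg_iff_add_eq_0 neg_equal_0_iff_equal)
  then show ?thesis
    unfolding killing_vectors_def by blast
qed

text \<open>By surjectivity both arguments may be taken in the image of \<open>\<alpha>\<close>;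
  then one \<open>\<alpha>\<close> comes out of the bracket and is removed by the isometry
  property.\<close>

lemma killing_alpha:
  assumes "v \<in> killing_vectors br \<alpha> g"
  shows "\<alpha> v \<in> killing_vectors br \<alpha> g"
  unfolding killing_iff_skew
proof (intro allI)
  fix x y
  obtain x' y' where "x = \<alpha> x'" "y = \<alpha> y'"
    using bij_alpha by (meson bij_pointE)
  moreover have "g (br v x') (\<alpha> y') = - g (br v y') (\<alpha> x')"
    using assms unfolding killing_iff_skew by blast
  ultimately show "g (br (\<alpha> v) x) (\<alpha> y) = - g (br (\<alpha> v) y) (\<alpha> x)"
    by (simp only: metric_alpha flip: alpha_br)
qed

lemma killing_br:
  assumes u: "u \<in> killing_vectors br \<alpha> g" and v: "v \<in> killing_vectors br \<alpha> g"
  shows "br u v \<in> killing_vectors br \<alpha> g"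
proof -
  have twisted_commutator: "br (br u v) (\<alpha> x) = br (\<alpha> u) (br v x) - br (\<alpha> v) (br u x)" for x
    using hom_Jacobi[of u v x]
    by (simp add: skew[of "br u v" "\<alpha> x"] skew[of x u] bilinear_rneg[OF bilinear_br]
        add_eq_0_iff2)
  \<comment> \<open>Skewness of \<open>br (\<alpha> w)\<close> on the pair \<open>z\<close>,
    \<open>\<alpha> y\<close> leaves a common \<open>\<alpha>\<close> on both sides of the metric.
    Removing it frees \<open>z\<close> of any twist, so \<open>z\<close> can be a bracket such as
    \<open>br v x\<close>.\<close>
  have transfer: "g (br (\<alpha> w) z) (\<alpha> (\<alpha> y)) = - g (br w y) z"
    if "w \<in> killing_vectors br \<alpha> g" for w y z
  proof -
    have "g (br (\<alpha> w) z) (\<alpha> (\<alpha> y)) = - g (br (\<alpha> w) (\<alpha> y)) (\<alpha> z)"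
      using killing_alpha[OF that] unfolding killing_iff_skew by blast
    then show ?thesis
      by (simp only: metric_alpha flip: alpha_br)
  qed
  have "g (br (br u v) (\<alpha> x)) (\<alpha> (\<alpha> y)) = g (br v y) (br u x) - g (br u y) (br v x)" for x y
    by (simp add: twisted_commutator bilinear_lsub[OF bilinear_metric] transfer u v)
  \<comment> \<open>By symmetry of \<open>g\<close>, exchanging \<open>x\<close> and
    \<open>y\<close> swaps the two terms of the difference.\<close>
  then have "g (br (br u v) (\<alpha> x)) (\<alpha> (\<alpha> y)) = - g (br (br u v) (\<alpha> y)) (\<alpha> (\<alpha> x))" for x y
    by (simp add: metric_sym)
  \<comment> \<open>So far the arguments are \<open>\<alpha> x\<close> and
    \<open>\<alpha> y\<close>; surjectivity makes them arbitrary.\<close>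
  then show ?thesis
    unfolding killing_iff_skew using bij_alpha by (metis bij_pointE)
qed

text \<open>For fixed \<open>x\<close> and \<open>y\<close> the condition in
  \<open>killing_iff_skew\<close> is linear in \<open>v\<close>.\<close>

lemma subspace_killing_vectors: "subspace (killing_vectors br \<alpha> g)"
proof (rule subspaceI)
  show "0 \<in> killing_vectors br \<alpha> g"
    by (simp add: killing_iff_skew bilinear_lzero[OF bilinear_br] bilinear_lzero[OF bilinear_metric])
next
  fix u v
  assume "u \<in> killing_vectors br \<alpha> g" "v \<in> killing_vectors br \<alpha> g"
  then have "g (br u x) (\<alpha> y) = - g (br u y) (\<alpha> x)" "g (br v x) (\<alpha> y) = - g (br v y) (\<alpha> x)" for x y
    unfolding killing_iff_skew by blast+
  then have "g (br u x) (\<alpha> y) + g (br v x) (\<alpha> y) = - (g (br u y) (\<alpha> x) + g (br v y) (\<alpha> x))" for x y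
    by (metis minus_add_distrib)
  then show "u + v \<in> killing_vectors br \<alpha> g"
    unfolding killing_iff_skew bilinear_ladd[OF bilinear_br] bilinear_ladd[OF bilinear_metric]
    by blast
next
  fix c v
  assume "v \<in> killing_vectors br \<alpha> g"
  \<comment> \<open>Real multiplication is written as \<open>*\<^sub>R\<close> to match the form
    produced by \<open>bilinear_lmul\<close>.\<close>
  then have "c *\<^sub>R g (br v x) (\<alpha> y) = - (c *\<^sub>R g (br v y) (\<alpha> x))" for x y
    unfolding killing_iff_skew by (metis scaleR_minus_right)
  then show "c *\<^sub>R v \<in> killing_vectors br \<alpha> g"
    unfolding killing_iff_skew bilinear_lmul[OF bilinear_br] bilinear_lmul[OF bilinear_metric]
    by blast
qed

end

theorem theorem15:
  fixes br :: "'a::real_vector \<Rightarrow> 'a \<Rightarrow> 'a" and \<alpha> :: "'a \<Rightarrow> 'a" and g :: "'a \<Rightarrow> 'a \<Rightarrow> real"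
  assumes "pseudo_riemannian_hom_lie_algebra br \<alpha> g"
  shows "hom_lie_subalgebra br \<alpha> (killing_vectors br \<alpha> g)"
proof -
  interpret pseudo_riemannian_hom_lie_algebra br \<alpha> g by fact
  show ?thesis
    unfolding hom_lie_subalgebra_def
    using subspace_killing_vectors killing_alpha killing_br by blast
qed

end
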